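(* Let $n$ be a positive integer. The complete graph $K_n$ admits a $(C_6,\overline{C}_6)$-multidecomposition if and only if $n \equiv 0 \text{ or } 1 \pmod{3}$, $n \geq 6$, and $n \notin \{7,9,10\}$.
   Context: $C_6$ denotes the cycle on 6 vertices and $\overline{C}_6$ denotes its complement in $K_6$ (the graph on 6 vertices with 9 edges consisting of two disjoint triangles $\{a,b,c\}$, $\{d,e,f\}$ together with the perfect matching $\{a,d\},\{b,e\},\{c,f\}$). For graphs $G$ and $H$, a $(G,H)$-multidecomposition of $K_n$ is a partition of the edge set of $K_n$ into edge-disjoint subgraphs each isomorphic to $G$ or to $H$, such that at least one subgraph isomorphic to $G$ and at least one subgraph isomorphic to $H$ occur in the partition. *)

theory Defs
  imports Main "HOL-Library.Disjoint_Sets"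
begin

record 'a ugraph =
  verts :: "'a set"
  edges :: "'a set set"

definition all_edges :: "'a set \<Rightarrow> 'a set set" where
  "all_edges V = {e. e \<subseteq> V \<and> card e = 2}"

definition simple_graph :: "'a ugraph \<Rightarrow> bool" where
  "simple_graph G \<longleftrightarrow> finite (verts G) \<and> edges G \<subseteq> all_edges (verts G)"

definition subgraph :: "'a ugraph \<Rightarrow> 'a ugraph \<Rightarrow> bool" where
  "subgraph H G \<longleftrightarrow> simple_graph H \<and> verts H \<subseteq> verts G \<and> edges H \<subseteq> edges G"

definition isomorphic :: "'a ugraph \<Rightarrow> 'b ugraph \<Rightarrow> bool" where
  "isomorphic G H \<longleftrightarrow>
     (\<exists>f. bij_betw f (verts G) (verts H) \<and>
          (\<forall>u \<in> verts G. \<forall>v \<in> verts G. {u, v} \<in> edges G \<longleftrightarrow> {f u, f v} \<in> edges H))"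

definition complete_graph :: "nat \<Rightarrow> nat ugraph" where
  "complete_graph n = \<lparr>verts = {..<n}, edges = all_edges {..<n}\<rparr>"

text \<open>Meaningful only for \<open>n \<ge> 3\<close>.\<close>

definition cycle_graph :: "nat \<Rightarrow> nat ugraph" where
  "cycle_graph n = \<lparr>verts = {..<n}, edges = {{i, (i + 1) mod n} | i. i < n}\<rparr>"

definition complement :: "'a ugraph \<Rightarrow> 'a ugraph" where
  "complement G = \<lparr>verts = verts G, edges = all_edges (verts G) - edges G\<rparr>"

text \<open>
  The parts are collected in a set rather than a multiset. No generality is lost when \<open>G\<close> and
  \<open>H\<close> have at least one edge, because then two edge-disjoint parts are different graphs.
\<close>

definition multidecomposition ::
  "'b ugraph \<Rightarrow> 'c ugraph \<Rightarrow> 'a ugraph \<Rightarrow> 'a ugraph set \<Rightarrow> bool" where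
  "multidecomposition G H K D \<longleftrightarrow>
     (\<forall>B \<in> D. subgraph B K \<and> (isomorphic B G \<or> isomorphic B H)) \<and>
     disjoint_family_on edges D \<and>
     (\<Union>B \<in> D. edges B) = edges K \<and>
     (\<exists>B \<in> D. isomorphic B G) \<and>
     (\<exists>B \<in> D. isomorphic B H)"

lemma simple_graph_complete_graph: "simple_graph (complete_graph n)"
  by (simp add: simple_graph_def complete_graph_def)

lemma edges_cycle_graph_6:
  "edges (cycle_graph 6) = {{0, 1}, {1, 2}, {2, 3}, {3, 4}, {4, 5}, {5, 0}}"
proof -
  have "{i. i < 6} = {0, 1, 2, 3, 4, 5::nat}" by auto
  moreover have "edges (cycle_graph 6) = (\<lambda>i. {i, (i + 1) mod 6}) ` {i. i < 6}"
    by (auto simp: cycle_graph_def)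
  ultimately show ?thesis by (simp del: One_nat_def add: Suc_1 Suc_eq_plus1)
qed

lemma simple_graph_cycle_graph_6: "simple_graph (cycle_graph 6)"
  unfolding simple_graph_def edges_cycle_graph_6
  by (simp add: all_edges_def cycle_graph_def card_insert_if)

text \<open>
  The complement of the 6-cycle consists of the triangles \<open>0,2,4\<close> and \<open>3,5,1\<close> and
  the perfect matching \<open>0,3\<close>; \<open>2,5\<close>; \<open>4,1\<close>.
\<close>

lemma edges_complement_cycle_graph_6:
  "edges (complement (cycle_graph 6)) =
     {{0, 2}, {2, 4}, {4, 0}, {3, 5}, {5, 1}, {1, 3}, {0, 3}, {2, 5}, {4, 1}}"
proof -
  have v: "{..<6} = {0, 1, 2, 3, 4, 5::nat}"
    by auto
  have w: "{0<..<6} = {1, 2, 3, 4, 5::nat}" "{1<..<6} = {2, 3, 4, 5::nat}"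
    "{2<..<6} = {3, 4, 5::nat}" "{3<..<6} = {4, 5::nat}" "{4<..<6} = {5::nat}"
    "{5<..<6} = ({} :: nat set)"
    by auto
  have "all_edges {..<6::nat} = (\<Union>u \<in> {..<6}. (\<lambda>w. {u, w}) ` {u<..<6})" (is "?L = ?R")
  proof
    show "?L \<subseteq> ?R"
    proof
      fix e assume "e \<in> ?L"
      then obtain x y where "e = {x, y}" "x \<noteq> y" "x < 6" "y < 6"
        by (auto simp: all_edges_def card_2_iff)
      then obtain x y where "e = {x, y}" "x < y" "y < 6"
        by (metis insert_commute linorder_neqE_nat)
      then have "x \<in> {..<6}" "e \<in> (\<lambda>w. {x, w}) ` {x<..<6}"
        by auto
      then show "e \<in> ?R"
        by blast
    qed
    show "?R \<subseteq> ?L"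
      by (auto simp: all_edges_def card_insert_if)
  qed
  also have "\<dots> =
      {{0, 1}, {0, 2}, {0, 3}, {0, 4}, {0, 5}, {1, 2}, {1, 3}, {1, 4}, {1, 5},
       {2, 3}, {2, 4}, {2, 5}, {3, 4}, {3, 5}, {4, 5}}"
    unfolding v
    by (simp add: w del: One_nat_def, intro equalityI subsetI; elim insertE emptyE; simp)
  finally have "all_edges {..<6::nat} =
      {{0, 1}, {0, 2}, {0, 3}, {0, 4}, {0, 5}, {1, 2}, {1, 3}, {1, 4}, {1, 5},
       {2, 3}, {2, 4}, {2, 5}, {3, 4}, {3, 5}, {4, 5}}" .
  moreover have "edges (complement (cycle_graph 6)) = all_edges {..<6} - edges (cycle_graph 6)"
    by (simp add: complement_def cycle_graph_def)
  ultimately have "edges (complement (cycle_graph 6)) =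
      {{0, 2}, {0, 3}, {0, 4}, {1, 3}, {1, 4}, {1, 5}, {2, 4}, {2, 5}, {3, 5}}"
    unfolding edges_cycle_graph_6 by (simp add: insert_Diff_if doubleton_eq_iff)
  also have "\<dots> = {{0, 2}, {2, 4}, {0, 4}, {3, 5}, {1, 5}, {1, 3}, {0, 3}, {2, 5}, {1, 4}}"
    by (intro equalityI subsetI; elim insertE emptyE; simp)
  finally show ?thesis
    by (simp only: insert_commute[of 4 0 "{}"] insert_commute[of 5 1 "{}"]
      insert_commute[of 4 1 "{}"])
qed

end

theory Submission
  imports Defs "HOL-Library.Product_Lexorder" "HOL-Library.Code_Binary_Nat"
begin

text \<open>
  The complement of the 6-cycle is the triangular prism. With \<open>c\<close> cycles and \<open>p\<close> prisms,
  counting edges gives \<open>n (n - 1) / 2 = 6 c + 9 p\<close>, and counting at a vertex that lies in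
  \<open>c'\<close> cycles and \<open>p'\<close> prisms gives \<open>n - 1 = 2 c' + 3 p'\<close>. The first equation excludes
  \<open>n \<equiv> 2 (mod 3)\<close>. For \<open>n = 7\<close> it forces \<open>p = 1\<close>, but \<open>p'\<close> is even. For \<open>n = 9\<close> it forces \<open>p = 2\<close>,
  and \<open>p'\<close> is even, so both prisms have the same six vertices, which span only 15 of the 18 edges needed.
  For \<open>n = 10\<close> every \<open>p'\<close> is odd, so \<open>p = 3\<close> (the value 1 leaves vertices
  outside all prisms, and 5 leaves no cycle) and exactly four vertices lie in all three prisms;
  each prism has at least three of the six edges between these four vertices.

  Conversely, \<open>K\<^bsub>a,6\<^esub>\<close> decomposes into 6-cycles for even \<open>a \<ge> 4\<close>, because \<open>K\<^bsub>4,6\<^esub>\<close> and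
  \<open>K\<^bsub>6,6\<^esub>\<close> do. Hence a decomposition of \<open>K\<^bsub>n\<^esub>\<close> extends to \<open>K\<^bsub>n+6\<^esub>\<close> for even
  \<open>n\<close> (adding a disjoint \<open>K\<^bsub>6\<^esub>\<close>) and to \<open>K\<^bsub>n+12\<^esub>\<close> for odd \<open>n\<close> (adding a \<open>K\<^bsub>13\<^esub>\<close>
  that shares one vertex). The remaining orders 6, 16 and 13, 15, 19, 21 have explicit
  decompositions.
\<close>

abbreviation "C6 \<equiv> cycle_graph 6"
abbreviation "prism \<equiv> complement C6"

subsection \<open>Decompositions of edge sets\<close>

text \<open>Parts are represented by their edge sets alone, so that a decomposition becomes a
  \<open>partition_on\<close>. Neither \<open>C6\<close> nor \<open>prism\<close> has an isolated
  vertex, hence the vertices are recovered as the union of the edges.\<close>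

definition copies :: "'b ugraph \<Rightarrow> 'a set set set" where
  "copies G = {(`) h ` edges G | h. inj_on h (verts G)}"

definition c6_decomposable :: "'a set set \<Rightarrow> bool" where
  "c6_decomposable E \<longleftrightarrow> (\<exists>P. partition_on E P \<and> P \<subseteq> copies C6)"

definition multidecomposable :: "'a set set \<Rightarrow> bool" where
  "multidecomposable E \<longleftrightarrow>
     (\<exists>P Q. partition_on E (P \<union> Q) \<and> P \<subseteq> copies C6 \<and> Q \<subseteq> copies prism \<and> P \<noteq> {} \<and> Q \<noteq> {})"

definition join_edges :: "'a set \<Rightarrow> 'a set \<Rightarrow> 'a set set" where
  "join_edges A B = {{a, b} | a b. a \<in> A \<and> b \<in> B}"

lemma verts_C6: "verts C6 = {..<6}"
  by (simp add: cycle_graph_def)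

lemma verts_prism: "verts prism = {..<6}"
  by (simp add: complement_def cycle_graph_def)

lemma simple_graph_prism: "simple_graph prism"
  by (auto simp: simple_graph_def complement_def cycle_graph_def)

lemma lessThan_6: "{..<6} = {0, 1, 2, 3, 4, 5::nat}"
  by auto

lemma Union_edges_C6: "\<Union>(edges C6) = {..<6}"
  unfolding edges_cycle_graph_6 lessThan_6 by auto

lemma Union_edges_prism: "\<Union>(edges prism) = {..<6}"
  unfolding edges_complement_cycle_graph_6 lessThan_6 by auto

text \<open>The inverse of the embedding \<open>h\<close> is the isomorphism. Non-edges cannot
  become edges, because taking images under \<open>h\<close> is injective on all subsets of
  \<open>verts G\<close>, not only on edges.\<close>

lemma copy_isomorphic:
  assumes "X \<in> copies G" "simple_graph G" "\<Union>(edges G) = verts G"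
  shows "isomorphic \<lparr>verts = \<Union>X, edges = X\<rparr> G" "simple_graph \<lparr>verts = \<Union>X, edges = X\<rparr>"
proof -
  from assms obtain h where h: "inj_on h (verts G)" "X = (`) h ` edges G"
    by (auto simp: copies_def)
  have U: "\<Union>X = h ` verts G"
    unfolding h(2) assms(3)[symmetric] by auto
  have fin: "finite (verts G)" and sub: "edges G \<subseteq> Pow (verts G)"
    and two: "\<And>e. e \<in> edges G \<Longrightarrow> card e = 2"
    using assms(2) by (auto simp: simple_graph_def all_edges_def)
  have inj: "inj_on ((`) h) (Pow (verts G))"
    using h(1) by (rule inj_on_image_Pow)
  have "{a, b} \<in> edges G \<longleftrightarrow> {h a, h b} \<in> X" if "a \<in> verts G" "b \<in> verts G" for a b
    using inj_on_image_mem_iff[OF inj _ sub, of "{a, b}"] that by (simp add: h(2))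
  then show "isomorphic \<lparr>verts = \<Union>X, edges = X\<rparr> G"
    unfolding isomorphic_def
    using h(1) by (intro exI[of _ "inv_into (verts G) h"])
      (auto simp: U inj_on_imp_bij_betw bij_betw_inv_into)
  show "simple_graph \<lparr>verts = \<Union>X, edges = X\<rparr>"
    unfolding simple_graph_def all_edges_def using fin two sub h
    by (auto simp: card_image inj_on_subset) (simp add: U[unfolded h(2)])
qed

lemma multidecomposition_exI:
  assumes "multidecomposable (all_edges {..<n})"
  shows "\<exists>D. multidecomposition C6 prism (complete_graph n) D"
proof -
  from assms obtain P Q where PQ: "partition_on (all_edges {..<n}) (P \<union> Q)"
    "P \<subseteq> copies C6" "Q \<subseteq> copies prism" "P \<noteq> {}" "Q \<noteq> {}"
    unfolding multidecomposable_def by blast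
  define mk where "mk X = \<lparr>verts = \<Union>X, edges = X\<rparr>" for X :: "nat set set"
  have P: "isomorphic (mk X) C6" "simple_graph (mk X)" if "X \<in> P" for X
    using copy_isomorphic[of X C6] that PQ(2)
    by (auto simp: mk_def simple_graph_cycle_graph_6 Union_edges_C6 verts_C6)
  have Q: "isomorphic (mk X) prism" "simple_graph (mk X)" if "X \<in> Q" for X
    using copy_isomorphic[of X prism] that PQ(3)
    by (auto simp: mk_def simple_graph_prism Union_edges_prism verts_prism)
  have all: "\<Union>(P \<union> Q) = all_edges {..<n}" and dis: "disjoint (P \<union> Q)"
    using PQ(1) by (auto simp: partition_on_def)
  have sub: "subgraph (mk X) (complete_graph n)" if "X \<in> P \<union> Q" for X
  proof -
    have "X \<subseteq> all_edges {..<n}"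
      using that all by blast
    then show ?thesis
      using that P Q by (force simp: subgraph_def mk_def complete_graph_def all_edges_def)
  qed
  have "multidecomposition C6 prism (complete_graph n) (mk ` (P \<union> Q))"
    unfolding multidecomposition_def
  proof (intro conjI)
    show "\<forall>B\<in>mk ` (P \<union> Q). subgraph B (complete_graph n) \<and> (isomorphic B C6 \<or> isomorphic B prism)"
      using sub P Q by blast
    show "disjoint_family_on edges (mk ` (P \<union> Q))"
      using dis by (auto simp: disjoint_family_on_def disjoint_def mk_def)
    show "(\<Union>B\<in>mk ` (P \<union> Q). edges B) = edges (complete_graph n)"
      using all by (auto simp: mk_def complete_graph_def)
    show "\<exists>B\<in>mk ` (P \<union> Q). isomorphic B C6" "\<exists>B\<in>mk ` (P \<union> Q). isomorphic B prism"
      using PQ(4,5) P Q by blast+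
  qed
  then show ?thesis by blast
qed

lemma partition_on_Un:
  assumes "partition_on A P" "partition_on B Q" "A \<inter> B = {}"
  shows "partition_on (A \<union> B) (P \<union> Q)"
proof -
  have "disjoint (P \<union> Q)"
    using assms by (intro disjoint_union) (auto simp: partition_on_def)
  then show ?thesis
    using assms by (auto simp: partition_on_def)
qed

lemma c6_decomposable_Un:
  assumes "c6_decomposable E" "c6_decomposable F" "E \<inter> F = {}"
  shows "c6_decomposable (E \<union> F)"
proof -
  obtain P Q where "partition_on E P" "partition_on F Q" "P \<subseteq> copies C6" "Q \<subseteq> copies C6"
    using assms(1,2) unfolding c6_decomposable_def by blast
  then show ?thesis
    using partition_on_Un[of E P F Q] assms(3) unfolding c6_decomposable_def
    by (intro exI[of _ "P \<union> Q"]) auto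
qed

lemma multidecomposable_Un_c6:
  assumes "multidecomposable E" "c6_decomposable F" "E \<inter> F = {}"
  shows "multidecomposable (E \<union> F)"
proof -
  from assms obtain P Q R where "partition_on E (P \<union> Q)" "P \<subseteq> copies C6" "Q \<subseteq> copies prism"
    "P \<noteq> {}" "Q \<noteq> {}" "partition_on F R" "R \<subseteq> copies C6"
    unfolding multidecomposable_def c6_decomposable_def by blast
  moreover have "partition_on (E \<union> F) ((P \<union> R) \<union> Q)"
    using partition_on_Un[of E "P \<union> Q" F R] calculation assms(3) by (simp add: Un_ac)
  ultimately show ?thesis
    unfolding multidecomposable_def by (intro exI[of _ "P \<union> R"] exI[of _ Q]) auto
qed

lemma multidecomposable_Un:
  assumes "multidecomposable E" "multidecomposable F" "E \<inter> F = {}"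
  shows "multidecomposable (E \<union> F)"
proof -
  obtain P Q where P: "partition_on E (P \<union> Q)" "P \<subseteq> copies C6" "Q \<subseteq> copies prism"
    "P \<noteq> {}" "Q \<noteq> {}"
    using assms(1) unfolding multidecomposable_def by blast
  obtain R S where R: "partition_on F (R \<union> S)" "R \<subseteq> copies C6" "S \<subseteq> copies prism"
    using assms(2) unfolding multidecomposable_def by blast
  have "partition_on (E \<union> F) ((P \<union> R) \<union> (Q \<union> S))"
    using partition_on_Un[OF P(1) R(1) assms(3)] by (simp add: Un_ac)
  then show ?thesis
    using P(2-5) R(2,3) unfolding multidecomposable_def
    by (intro exI[of _ "P \<union> R"] exI[of _ "Q \<union> S"]) auto
qed

section \<open>Transport along injections of the vertices\<close>

lemma copies_image:
  assumes "X \<in> copies G" "\<Union>(edges G) = verts G" "inj_on g (\<Union>X)"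
  shows "(`) g ` X \<in> copies G"
proof -
  from assms(1) obtain h where h: "inj_on h (verts G)" "X = (`) h ` edges G"
    by (auto simp: copies_def)
  have "\<Union>X = h ` verts G"
    unfolding h(2) assms(2)[symmetric] by auto
  then have "inj_on (g \<circ> h) (verts G)"
    using h(1) assms(3) by (simp add: comp_inj_on)
  moreover have "(`) g ` X = (`) (g \<circ> h) ` edges G"
    unfolding h(2) image_image by (simp add: image_comp)
  ultimately show ?thesis
    unfolding copies_def by blast
qed

lemma partition_on_image:
  assumes "partition_on A P" "inj_on f A"
  shows "partition_on (f ` A) ((`) f ` P)"
  \<comment> \<open>The image partition is first obtained with the empty set removed; no block is
    empty, so the removal changes nothing.\<close>
  using partition_on_inj_image[OF assms] partition_onD3[OF assms(1)]
  by (simp add: image_iff Diff_insert0)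

text \<open>Only one half \<open>P\<close> of the blocks is moved, so that cycles and prisms are
  treated by the same argument with the two halves exchanged.\<close>

lemma copies_images:
  assumes "partition_on E (P \<union> Q)" "P \<subseteq> copies G" "\<Union>(edges G) = verts G" "inj_on g (\<Union>E)"
  shows "(`) ((`) g) ` P \<subseteq> copies G"
proof -
  have "inj_on g (\<Union>X)" if "X \<in> P" for X
    using that assms(1,4) by (auto intro: inj_on_subset dest!: partition_onD1)
  then show ?thesis
    using assms(2,3) copies_image by blast
qed

lemma c6_decomposable_image:
  assumes "c6_decomposable E" "inj_on g (\<Union>E)"
  shows "c6_decomposable ((`) g ` E)"
proof -
  from assms obtain P where P: "partition_on E P" "P \<subseteq> copies C6"
    unfolding c6_decomposable_def by blast
  have "partition_on ((`) g ` E) ((`) ((`) g) ` P)"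
    using P(1) assms(2) by (intro partition_on_image inj_on_image)
  moreover have "(`) ((`) g) ` P \<subseteq> copies C6"
    using copies_images[of E P "{}" C6 g] P assms(2) by (simp add: Union_edges_C6 verts_C6)
  ultimately show ?thesis
    unfolding c6_decomposable_def by blast
qed

lemma multidecomposable_image:
  assumes "multidecomposable E" "inj_on g (\<Union>E)"
  shows "multidecomposable ((`) g ` E)"
proof -
  from assms obtain P Q where P: "partition_on E (P \<union> Q)" "P \<subseteq> copies C6" "Q \<subseteq> copies prism"
    "P \<noteq> {}" "Q \<noteq> {}"
    unfolding multidecomposable_def by blast
  have "partition_on ((`) g ` E) ((`) ((`) g) ` (P \<union> Q))"
    using P(1) assms(2) by (intro partition_on_image inj_on_image)
  then have "partition_on ((`) g ` E) ((`) ((`) g) ` P \<union> (`) ((`) g) ` Q)"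
    by (simp add: image_Un)
  moreover have "(`) ((`) g) ` P \<subseteq> copies C6"
    using copies_images[of E P Q C6 g] P assms(2) by (simp add: Union_edges_C6 verts_C6)
  moreover have "(`) ((`) g) ` Q \<subseteq> copies prism"
    using copies_images[of E Q P prism g] P assms(2) 
    by (simp add: Un_commute Union_edges_prism verts_prism)
  ultimately show ?thesis
    using P(4,5) unfolding multidecomposable_def by (metis image_is_empty)
qed

lemma all_edges_image:
  assumes "inj_on g A"
  shows "all_edges (g ` A) = (`) g ` all_edges A"
proof -
  have "e \<in> (`) g ` all_edges A" if "e \<subseteq> g ` A" "card e = 2" for e
  proof -
    from that(1) obtain d where "d \<subseteq> A" "e = g ` d"
      by (auto simp: subset_image_iff)
    then show ?thesis
      using that(2) assms by (auto simp: all_edges_def card_image inj_on_subset)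
  qed
  then show ?thesis
    using assms by (auto simp: all_edges_def card_image inj_on_subset)
qed

lemma Union_all_edges_subset: "\<Union>(all_edges A) \<subseteq> A"
  by (auto simp: all_edges_def)

lemma multidecomposable_all_edges:
  assumes "multidecomposable (all_edges {..<m})" "finite A" "card A = m"
  shows "multidecomposable (all_edges A)"
proof -
  obtain g where g: "bij_betw g {..<m} A"
    using assms(2,3) ex_bij_betw_nat_finite[of A] by (auto simp: atLeast0LessThan)
  have "multidecomposable ((`) g ` all_edges {..<m})"
    using assms(1)
      inj_on_subset[OF bij_betw_imp_inj_on[OF g] Union_all_edges_subset]
    by (rule multidecomposable_image)
  then show ?thesis
    using g all_edges_image[of g "{..<m}"] by (simp add: bij_betw_def)
qed

lemma join_edges_eq: "join_edges A B = (\<lambda>(a, b). {a, b}) ` (A \<times> B)"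
  by (auto simp: join_edges_def)

lemma join_edges_image: "join_edges (g ` A) (g ` B) = (`) g ` join_edges A B"
proof -
  have "g ` A \<times> g ` B = map_prod g g ` (A \<times> B)"
    by auto
  then show ?thesis
    by (simp add: join_edges_eq image_image case_prod_unfold)
qed

lemma c6_decomposable_join_transport:
  assumes "c6_decomposable (join_edges {..<a} {a..<a + b})"
    "finite A" "card A = a" "finite B" "card B = b" "A \<inter> B = {}"
  shows "c6_decomposable (join_edges A B)"
proof -
  obtain f where f: "bij_betw f {..<a} A"
    using assms ex_bij_betw_nat_finite[of A] by (auto simp: atLeast0LessThan)
  obtain g where g: "bij_betw g {a..<a + b} B"
    using assms(4,5) finite_same_card_bij[of "{a..<a+b}" B] by auto
  \<comment> \<open>The two bijections are glued into one vertex map; it is injective because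
    \<open>A\<close> and \<open>B\<close> are disjoint.\<close>
  define h where "h x = (if x < a then f x else g x)" for x
  have hf: "h ` {..<a} = A"
    using f unfolding bij_betw_def by (auto simp: h_def)
  have hg: "h ` {a..<a + b} = B"
    using g unfolding bij_betw_def by (auto simp: h_def)
  have "inj_on h {..<a}" "inj_on h {a..<a + b}"
    using f g by (auto simp: bij_betw_def h_def inj_on_def)
  then have "inj_on h ({..<a} \<union> {a..<a + b})"
    unfolding inj_on_Un using assms(6) hf hg by blast
  moreover have "\<Union>(join_edges {..<a} {a..<a + b}) \<subseteq> {..<a} \<union> {a..<a + b}"
    by (auto simp: join_edges_def)
  ultimately have "c6_decomposable ((`) h ` join_edges {..<a} {a..<a + b})"
    using assms(1) c6_decomposable_image inj_on_subset by blast
  then show ?thesis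
    using join_edges_image[of h "{..<a}" "{a..<a + b}"] by (simp add: hf hg)
qed

subsection \<open>Explicit decompositions\<close>

text \<open>
  A list of six vertices stands for the image of the cycle \<open>0, \<dots>, 5\<close>, or of its complement,
  under \<open>i \<mapsto> xs ! i\<close>. Edges are encoded as ordered pairs.
\<close>

definition cycle6 :: "nat list \<Rightarrow> (nat \<times> nat) list" where
  "cycle6 xs = map (\<lambda>(i, j). (min (xs ! i) (xs ! j), max (xs ! i) (xs ! j)))
     [(0, 1), (1, 2), (2, 3), (3, 4), (4, 5), (5, 0)]"

definition prism6 :: "nat list \<Rightarrow> (nat \<times> nat) list" where
  "prism6 xs = map (\<lambda>(i, j). (min (xs ! i) (xs ! j), max (xs ! i) (xs ! j)))
     [(0, 2), (2, 4), (4, 0), (3, 5), (5, 1), (1, 3), (0, 3), (2, 5), (4, 1)]"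

text \<open>One comparison of lists checks covering and edge-disjointness together, since the
  right-hand side lists every wanted edge exactly once and, for increasing \<open>as\<close> and
  \<open>bs\<close>, in lexicographic order. Equal intervals describe a complete graph, two
  consecutive ones a complete bipartite graph.\<close>

definition certificate :: "nat list list \<Rightarrow> nat list list \<Rightarrow> nat list \<Rightarrow> nat list \<Rightarrow> bool" where
  "certificate cs ps as bs \<longleftrightarrow>
     (\<forall>xs \<in> set cs \<union> set ps. length xs = 6 \<and> distinct xs) \<and>
     sort (concat (map cycle6 cs @ map prism6 ps)) =
       filter (\<lambda>(i, j). i < j) (List.product as bs)"

definition edge :: "'a \<times> 'a \<Rightarrow> 'a set" where
  "edge = (\<lambda>(i, j). {i, j})"

lemma inj_on_edge: "inj_on edge {(i, j). i < (j :: 'a :: linorder)}"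
  by (auto simp: inj_on_def edge_def doubleton_eq_iff)

lemma edge_min_max: "edge (min a b, max a b) = {a, b :: 'a :: linorder}"
  by (auto simp: edge_def min_def max_def)

lemma edge_cycle6: "edge ` set (cycle6 xs) = (`) ((!) xs) ` edges C6"
  unfolding cycle6_def edges_cycle_graph_6 by (simp add: edge_min_max)

lemma edge_prism6: "edge ` set (prism6 xs) = (`) ((!) xs) ` edges prism"
  unfolding prism6_def edges_complement_cycle_graph_6 by (simp add: edge_min_max)

lemma partition_on_set_concat:
  assumes "distinct (concat xss)" "[] \<notin> set xss"
  shows "partition_on (set (concat xss)) (set ` set xss)"
  using assms by (auto simp: partition_on_def disjoint_def distinct_concat_iff)

text \<open>Sorting keeps distinctness, so equality with a list without repetitions makes the listed
  pairs distinct, which separates the blocks. The map \<open>edge\<close> is injective on increasing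
  pairs and carries the partition over to edges.\<close>

lemma certificate_partition:
  assumes "certificate cs ps as bs" "distinct as" "distinct bs"
  defines "P \<equiv> (\<lambda>xs. edge ` set (cycle6 xs)) ` set cs"
    and "Q \<equiv> (\<lambda>xs. edge ` set (prism6 xs)) ` set ps"
  shows "partition_on (edge ` {(i, j) \<in> set as \<times> set bs. i < j}) (P \<union> Q)"
    "P \<subseteq> copies C6" "Q \<subseteq> copies prism"
proof -
  define xss where "xss = map cycle6 cs @ map prism6 ps"
  have eq: "sort (concat xss) = filter (\<lambda>(i, j). i < j) (List.product as bs)"
    and len: "\<And>xs. xs \<in> set cs \<union> set ps \<Longrightarrow> length xs = 6 \<and> distinct xs"
    using assms(1) by (auto simp: certificate_def xss_def)
  have "distinct (concat xss)"
    using assms(2,3) by (subst distinct_sort[symmetric], subst eq) (simp add: distinct_product)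
  moreover have "[] \<notin> set xss"
    by (auto simp: xss_def cycle6_def prism6_def)
  ultimately have "partition_on (set (concat xss)) (set ` set xss)"
    by (rule partition_on_set_concat)
  moreover have tgt: "set (concat xss) = {(i, j) \<in> set as \<times> set bs. i < j}"
    by (subst set_sort[symmetric], subst eq) auto
  ultimately have "partition_on (edge ` {(i, j) \<in> set as \<times> set bs. i < j}) ((`) edge ` set ` set xss)"
    by (intro partition_on_image) (auto intro: inj_on_subset[OF inj_on_edge])
  moreover have "(`) edge ` set ` set xss = P \<union> Q"
    by (auto simp: xss_def P_def Q_def image_Un image_image)
  ultimately show "partition_on (edge ` {(i, j) \<in> set as \<times> set bs. i < j}) (P \<union> Q)"
    by simp
  have "inj_on ((!) xs) {..<6}" if "xs \<in> set cs \<union> set ps" for xs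
    using len[OF that] by (auto intro: inj_on_nth)
  then show "P \<subseteq> copies C6" "Q \<subseteq> copies prism"
    unfolding P_def Q_def copies_def edge_cycle6 edge_prism6 verts_C6 verts_prism by blast+
qed

lemma all_edges_lessThan:
  fixes n :: nat
  shows "all_edges {..<n} = edge ` {(i, j) \<in> {0..<n} \<times> {0..<n}. i < j}"
proof (intro equalityI subsetI)
  fix e assume e: "e \<in> all_edges {..<n}"
  then obtain x y where "e = {x, y}" "x \<noteq> y"
    by (auto simp: all_edges_def card_2_iff)
  then obtain i j where ij: "e = {i, j}" "i < j"
    by (metis insert_commute linorder_neqE_nat)
  then have "(i, j) \<in> {(i, j) \<in> {0..<n} \<times> {0..<n}. i < j}"
    using e by (simp add: all_edges_def)
  moreover have "e = edge (i, j)"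
    by (simp add: ij edge_def)
  ultimately show "e \<in> edge ` {(i, j) \<in> {0..<n} \<times> {0..<n}. i < j}"
    by (rule rev_image_eqI)
next
  fix e assume "e \<in> edge ` {(i, j) \<in> {0..<n} \<times> {0..<n}. i < j}"
  then obtain i j where "e = edge (i, j)" "i < j" "j < n"
    by auto
  then show "e \<in> all_edges {..<n}"
    by (simp add: all_edges_def edge_def)
qed

lemma multidecomposable_certificate:
  assumes "certificate cs ps [0..<n] [0..<n]" "cs \<noteq> []" "ps \<noteq> []"
  shows "multidecomposable (all_edges {..<n})"
  using certificate_partition[OF assms(1)] assms(2,3)
  unfolding multidecomposable_def all_edges_lessThan
  by (intro exI[of _ "(\<lambda>xs. edge ` set (cycle6 xs)) ` set cs"]
      exI[of _ "(\<lambda>xs. edge ` set (prism6 xs)) ` set ps"]) simp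

lemma c6_decomposable_certificate:
  assumes "certificate cs [] [0..<a] [a..<a + b]"
  shows "c6_decomposable (join_edges {..<a} {a..<a + b})"
proof -
  \<comment> \<open>Every element of the first interval lies below every element of the second, so
    the condition \<open>i < j\<close> discards no pair.\<close>
  have "join_edges {..<a} {a..<a + b} = edge ` {(i, j) \<in> {0..<a} \<times> {a..<a + b}. i < j}"
    by (force simp: join_edges_def edge_def)
  then show ?thesis
    using certificate_partition[OF assms] unfolding c6_decomposable_def by auto
qed

section \<open>Complete bipartite graphs decomposed into 6-cycles\<close>

lemma c6_decomposable_join_4_6:
  "c6_decomposable (join_edges {..<4::nat} {4..<4 + 6})"
  by (rule c6_decomposable_certificate[of "[[2, 4, 0, 5, 3, 6], [3, 8, 0, 7, 1, 4],
        [3, 7, 2, 8, 1, 9], [1, 5, 2, 9, 0, 6]]"])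
    code_simp

lemma c6_decomposable_join_6_6:
  "c6_decomposable (join_edges {..<6::nat} {6..<6 + 6})"
  by (rule c6_decomposable_certificate[of "[[1, 6, 3, 11, 5, 7], [3, 9, 0, 7, 4, 10],
        [0, 10, 5, 9, 2, 6], [5, 6, 4, 11, 1, 8], [2, 8, 4, 9, 1, 10], [3, 8, 0, 11, 2, 7]]"])
    code_simp

lemma join_edges_Un: "join_edges (A \<union> B) C = join_edges A C \<union> join_edges B C"
  by (auto simp: join_edges_def)

lemma join_edges_disjoint:
  assumes "A \<inter> B = {}" "(A \<union> B) \<inter> C = {}"
  shows "join_edges A C \<inter> join_edges B C = {}"
  using assms by (auto simp: join_edges_def doubleton_eq_iff)

text \<open>Every even number from 4 on is a sum of fours and at most one six. Splitting off four
  vertices of \<open>A\<close> at a time therefore ends in one of the two explicit cases.\<close>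

lemma c6_decomposable_join:
  assumes "finite A" "even (card A)" "card A \<ge> 4" "finite B" "card B = 6" "A \<inter> B = {}"
  shows "c6_decomposable (join_edges A B)"
  using assms
proof (induction "card A" arbitrary: A rule: less_induct)
  case less
  show ?case
  proof (cases "card A = 4 \<or> card A = 6")
    case True
    then show ?thesis
      using less.prems c6_decomposable_join_transport c6_decomposable_join_4_6
        c6_decomposable_join_6_6 by blast
  next
    case False
    \<comment> \<open>Evenness rules out 5 and 7, so at least four vertices remain after four are
      removed.\<close>
    then have "card A \<ge> 8"
      using less.prems(2,3) by (auto elim!: evenE)
    then obtain A1 where A1: "A1 \<subseteq> A" "card A1 = 4" "finite A1"
      using obtain_subset_with_card_n[of 4 A] by auto
    have card: "card (A - A1) = card A - 4"
      using A1 less.prems by (simp add: card_Diff_subset)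
    have "c6_decomposable (join_edges A1 B)"
      using A1 less.prems by (intro c6_decomposable_join_transport[OF c6_decomposable_join_4_6]) auto
    moreover have "c6_decomposable (join_edges (A - A1) B)"
      using less.prems \<open>card A \<ge> 8\<close> by (intro less.hyps) (auto simp: card)
    moreover have "join_edges A1 B \<inter> join_edges (A - A1) B = {}"
      using A1 less.prems by (intro join_edges_disjoint) auto
    ultimately have "c6_decomposable (join_edges (A1 \<union> (A - A1)) B)"
      unfolding join_edges_Un by (rule c6_decomposable_Un)
    then show ?thesis
      using A1 by (simp add: Un_absorb1)
  qed
qed

section \<open>Gluing complete graphs along at most one vertex\<close>

lemma all_edges_Un:
  "all_edges (A \<union> B) = all_edges A \<union> all_edges B \<union> join_edges (A - B) (B - A)"
proof -
  have "e \<in> all_edges A \<union> all_edges B \<union> join_edges (A - B) (B - A)" if e: "e \<in> all_edges (A \<union> B)" for e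
  proof -
    obtain x y where "e = {x, y}" "x \<noteq> y"
      using e by (auto simp: all_edges_def card_2_iff)
    then show ?thesis
      using e by (auto simp: all_edges_def join_edges_def insert_commute)
  qed
  then show ?thesis
    by (auto simp: all_edges_def join_edges_def card_insert_if)
qed

text \<open>A common edge would need two common vertices, and a joining edge has an end outside
  \<open>A\<close> and an end outside \<open>B\<close>.\<close>

lemma all_edges_Un_disjoint:
  assumes "card (A \<inter> B) \<le> 1" "finite (A \<inter> B)"
  shows "all_edges A \<inter> all_edges B = {}"
    "(all_edges A \<union> all_edges B) \<inter> join_edges (A - B) (B - A) = {}"
proof -
  have *: "card e \<noteq> 2" if "e \<subseteq> A \<inter> B" for e
    using card_mono[OF assms(2) that] assms(1) by linarith
  show "all_edges A \<inter> all_edges B = {}"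
    unfolding all_edges_def using * by blast
  show "(all_edges A \<union> all_edges B) \<inter> join_edges (A - B) (B - A) = {}"
    by (auto simp: all_edges_def join_edges_def)
qed

text \<open>Common form of both extension steps: the two vertex sets are disjoint for even orders
  and share one vertex for odd orders.\<close>

lemma multidecomposable_all_edges_Un:
  assumes "multidecomposable (all_edges A)" "multidecomposable (all_edges B)"
    "card (A \<inter> B) \<le> 1" "finite (A \<inter> B)" "c6_decomposable (join_edges (A - B) (B - A))"
  shows "multidecomposable (all_edges (A \<union> B))"
  unfolding all_edges_Un using all_edges_Un_disjoint[OF assms(3,4)]
  by (intro multidecomposable_Un_c6[OF multidecomposable_Un] assms)

section \<open>Small orders with explicit decompositions\<close>

lemma multidecomposable_6: "multidecomposable (all_edges {..<6::nat})"
  \<comment> \<open>The same list serves twice: the complete graph is the union of a 6-cycle and its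
    complement.\<close>
  by (rule multidecomposable_certificate[of "[[0..<6]]" "[[0..<6]]"]) (code_simp, simp_all)

text \<open>For odd order each vertex lies in an even number of prisms. Here and for 15, 19 and 21
  the prisms follow a cyclic sequence of disjoint vertex triples (four triples for 13 and 21, three
  for 15 and 19), each prism occupying two consecutive triples; so a vertex lies in two prisms or in
  none.\<close>

lemma multidecomposable_13: "multidecomposable (all_edges {..<13::nat})"
  by (rule multidecomposable_certificate[of
    "[[0, 12, 9, 5, 10, 8], [2, 6, 12, 5, 4, 9], [2, 12, 10, 0, 7, 8], [3, 9, 11, 5, 7, 12],
     [3, 10, 4, 1, 7, 2], [8, 12, 4, 11, 6, 1], [11, 12, 1, 0, 6, 3]]"
    "[[4, 5, 3, 2, 0, 1], [7, 8, 6, 3, 4, 5], [9, 10, 8, 7, 6, 11], [2, 1, 0, 10, 11, 9]]"])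
    (code_simp, simp_all)

lemma multidecomposable_15: "multidecomposable (all_edges {..<15::nat})"
  by (rule multidecomposable_certificate[of
    "[[0, 12, 6, 9, 10, 1], [1, 9, 2, 13, 8, 12], [2, 3, 13, 1, 14, 12], [4, 14, 5, 1, 11, 13],
     [5, 10, 3, 4, 11, 6], [5, 12, 10, 0, 14, 9], [6, 8, 10, 4, 12, 13], [6, 14, 7, 9, 11, 10],
     [7, 11, 14, 2, 10, 13], [8, 9, 4, 7, 10, 14], [9, 12, 7, 2, 11, 3], [9, 13, 5, 11, 8, 0],
     [13, 14, 3, 12, 11, 0]]"
    "[[1, 0, 2, 3, 4, 5], [6, 8, 7, 4, 3, 5], [6, 8, 0, 1, 2, 7]]"])
    (code_simp, simp_all)

text \<open>This order cannot be reached from 10 and needs its own decomposition. Each vertex must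
  lie in an odd number of prisms: the vertices 0 to 3 lie in three of the four, all others in
  one.\<close>

lemma multidecomposable_16: "multidecomposable (all_edges {..<16::nat})"
  by (rule multidecomposable_certificate[of
    "[[0, 12, 7, 1, 9, 5], [0, 13, 11, 5, 2, 6], [3, 4, 12, 14, 13, 10], [3, 12, 9, 15, 4, 14],
     [4, 9, 8, 12, 13, 5], [4, 13, 3, 15, 6, 8], [6, 11, 9, 7, 15, 1], [6, 14, 8, 11, 2, 10],
     [7, 10, 15, 5, 12, 6], [7, 11, 1, 8, 10, 4], [7, 13, 6, 9, 10, 14], [8, 13, 9, 14, 11, 15],
     [10, 11, 4, 0, 8, 5], [12, 15, 14, 5, 7, 2]]"
    "[[1, 3, 4, 5, 2, 6], [3, 0, 8, 9, 7, 2], [3, 10, 11, 1, 0, 12], [0, 2, 1, 15, 14, 13]]"])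
    (code_simp, simp_all)

lemma multidecomposable_19: "multidecomposable (all_edges {..<19::nat})"
  by (rule multidecomposable_certificate[of
    "[[0, 7, 11, 4, 17, 5], [0, 10, 5, 12, 8, 15], [0, 11, 13, 3, 18, 17], [0, 12, 3, 11, 1, 13],
     [0, 16, 5, 14, 2, 18], [1, 12, 14, 9, 4, 18], [2, 13, 9, 8, 18, 11], [2, 15, 10, 17, 13, 8],
     [3, 14, 0, 9, 11, 10], [4, 12, 2, 3, 16, 15], [6, 10, 9, 3, 7, 13], [6, 12, 18, 5, 9, 16],
     [6, 15, 9, 2, 16, 18], [7, 15, 13, 4, 16, 12], [8, 10, 4, 6, 11, 14], [8, 11, 5, 4, 14, 16],
     [8, 17, 3, 15, 14, 1], [9, 12, 17, 16, 10, 1], [10, 12, 11, 15, 18, 7], [10, 18, 9, 17, 7, 14],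
     [11, 16, 7, 9, 6, 17], [12, 15, 1, 6, 14, 13], [13, 16, 1, 17, 2, 10], [13, 18, 14, 17, 15, 5]]"
    "[[0, 1, 2, 3, 4, 5], [7, 8, 6, 4, 5, 3], [6, 1, 8, 2, 0, 7]]"])
    (code_simp, simp_all)

lemma multidecomposable_21: "multidecomposable (all_edges {..<21::nat})"
  by (rule multidecomposable_certificate[of
    "[[0, 5, 14, 19, 20, 13], [0, 7, 18, 4, 13, 14], [0, 17, 13, 18, 2, 19], [0, 20, 12, 9, 17, 15],
     [1, 13, 11, 16, 6, 12], [1, 18, 3, 20, 6, 15], [2, 7, 13, 5, 6, 14], [2, 8, 18, 11, 20, 10],
     [2, 12, 17, 1, 14, 4], [3, 12, 16, 20, 7, 1], [3, 14, 9, 20, 18, 15], [3, 16, 8, 17, 18, 0],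
     [4, 8, 7, 14, 15, 10], [4, 9, 3, 19, 12, 15], [4, 17, 2, 6, 0, 12], [4, 19, 15, 13, 3, 11],
     [4, 20, 15, 8, 0, 16], [6, 13, 2, 15, 16, 1], [6, 17, 10, 14, 18, 9], [7, 15, 9, 13, 10, 19],
     [7, 17, 5, 10, 11, 12], [8, 14, 11, 7, 16, 19], [10, 18, 5, 20, 2, 16], [11, 15, 5, 9, 1, 19],
     [12, 13, 19, 9, 16, 5], [14, 20, 1, 8, 13, 16], [17, 19, 6, 18, 12, 14], [17, 20, 8, 12, 10, 3],
     [18, 19, 5, 11, 17, 16]]"
    "[[1, 2, 4, 5, 0, 3], [3, 4, 8, 7, 6, 5], [9, 10, 11, 7, 8, 6], [1, 9, 11, 10, 2, 0]]"])
    (code_simp, simp_all)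

section \<open>Extension by 6 and by 12 vertices, and the inductions\<close>

lemma multidecomposable_add_6:
  assumes "multidecomposable (all_edges {..<n::nat})" "even n" "n \<ge> 4"
  shows "multidecomposable (all_edges {..<n + 6})"
proof -
  have 1: "{..<n} - {n..<n + 6} = {..<n}" "{n..<n + 6} - {..<n} = {n..<n + 6}"
    "{..<n} \<inter> {n..<n + 6} = {}" "{..<n} \<union> {n..<n + 6} = {..<n + 6}"
    by auto
  have "multidecomposable (all_edges {n..<n + 6})"
    by (rule multidecomposable_all_edges[OF multidecomposable_6]) auto
  moreover have "c6_decomposable (join_edges {..<n} {n..<n + 6})"
    using assms(2,3) by (intro c6_decomposable_join) auto
  ultimately have "multidecomposable (all_edges ({..<n} \<union> {n..<n + 6}))"
    using assms(1) by (intro multidecomposable_all_edges_Un) (simp_all only: 1, simp_all)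
  then show ?thesis
    by (simp only: 1)
qed

lemma join_edges_commute: "join_edges A B = join_edges B A"
  by (auto simp: join_edges_def insert_commute)

lemma c6_decomposable_join_12:
  assumes "finite A" "even (card A)" "card A \<ge> 4" "finite B" "card B = 12" "A \<inter> B = {}"
  shows "c6_decomposable (join_edges A B)"
proof -
  obtain B1 where B1: "B1 \<subseteq> B" "card B1 = 6" "finite B1"
    using obtain_subset_with_card_n[of 6 B] assms by auto
  have "c6_decomposable (join_edges A B1)" "c6_decomposable (join_edges A (B - B1))"
    using assms B1 by (auto intro!: c6_decomposable_join simp: card_Diff_subset)
  then have "c6_decomposable (join_edges B1 A)" "c6_decomposable (join_edges (B - B1) A)"
    by (simp_all only: join_edges_commute[of A])
  moreover have "join_edges B1 A \<inter> join_edges (B - B1) A = {}"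
    using B1 assms by (intro join_edges_disjoint) auto
  ultimately have "c6_decomposable (join_edges (B1 \<union> (B - B1)) A)"
    unfolding join_edges_Un by (intro c6_decomposable_Un)
  then show ?thesis
    using B1 by (simp add: Un_absorb1 join_edges_commute[of A])
qed

text \<open>The block of 13 vertices contains the old vertex \<open>n - 1\<close>, so only the other
  \<open>n - 1\<close> old vertices, an even number, are joined to the 12 new ones. Without the
  overlap each new vertex would have odd degree \<open>n\<close> in the bipartite part, which
  6-cycles cannot cover.\<close>

lemma multidecomposable_add_12:
  assumes "multidecomposable (all_edges {..<n::nat})" "odd n" "n \<ge> 5"
  shows "multidecomposable (all_edges {..<n + 12})"
proof -
  have 1: "{..<n} - {n - 1..<n + 12} = {..<n - 1}" "{n - 1..<n + 12} - {..<n} = {n..<n + 12}"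
    "{..<n} \<inter> {n - 1..<n + 12} = {n - 1}" "{..<n} \<union> {n - 1..<n + 12} = {..<n + 12}"
    using assms(3) by auto
  have "multidecomposable (all_edges {n - 1..<n + 12})"
    using assms(3) by (intro multidecomposable_all_edges[OF multidecomposable_13]) auto
  moreover have "c6_decomposable (join_edges {..<n - 1} {n..<n + 12})"
    using assms(2,3) by (intro c6_decomposable_join_12) auto
  ultimately have "multidecomposable (all_edges ({..<n} \<union> {n - 1..<n + 12}))"
    using assms(1) by (intro multidecomposable_all_edges_Un) (simp_all only: 1, simp_all)
  then show ?thesis
    by (simp only: 1)
qed

text \<open>The admissible even orders are 0 and 4 modulo 6. Since 10 is excluded, the second class
  starts at 16.\<close>

lemma multidecomposable_even:
  assumes "even n" "n mod 3 \<noteq> 2" "n \<ge> 6" "n \<noteq> 10"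
  shows "multidecomposable (all_edges {..<n::nat})"
  using assms
proof (induction n rule: less_induct)
  case (less n)
  show ?case
  proof (cases "n = 6 \<or> n = 16")
    case True
    then show ?thesis
      using multidecomposable_6 multidecomposable_16 by auto
  next
    case False
    have "n \<in> {6, 7, 8, 9, 10, 11}" if "n < 12"
      using that less.prems(3) by auto
    then have "12 \<le> n"
      using False less.prems by (cases "n < 12") auto
    then obtain m where m: "n = m + 6" "m \<ge> 6"
      using that[of "n - 6"] by simp
    have "(m + 6) mod 3 = m mod 3"
      using mod_mult_self1[of m 2 3] by simp
    \<comment> \<open>Here \<open>m\<close> differs from 10 because \<open>n\<close> differs from
      16.\<close>
    then have "multidecomposable (all_edges {..<m})"
      using m less.prems False by (intro less.IH) auto
    then show ?thesis
      using multidecomposable_add_6[of m] m less.prems by simp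
  qed
qed

text \<open>The admissible odd orders are 1, 3, 7 and 9 modulo 12; the smallest members from 13 on
  are 13, 15, 19 and 21.\<close>

lemma multidecomposable_odd:
  assumes "odd n" "n mod 3 \<noteq> 2" "n \<ge> 13"
  shows "multidecomposable (all_edges {..<n::nat})"
  using assms
proof (induction n rule: less_induct)
  case (less n)
  show ?case
  proof (cases "n \<in> {13, 15, 19, 21}")
    case True
    then show ?thesis
      using multidecomposable_13 multidecomposable_15 multidecomposable_19 multidecomposable_21
      by auto
  next
    case False
    have "n \<in> {13, 14, 15, 16, 17, 18, 19, 20, 21, 22, 23, 24}" if "n < 25"
      using that less.prems(3) by simp presburger
    then have "25 \<le> n"
      using False less.prems by (cases "n < 25") auto
    then obtain m where m: "n = m + 12" "m \<ge> 13"
      using that[of "n - 12"] by simp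
    have "(m + 12) mod 3 = m mod 3"
      using mod_mult_self1[of m 4 3] by simp
    then have "multidecomposable (all_edges {..<m})"
      using m less.prems by (intro less.IH) auto
    then show ?thesis
      using multidecomposable_add_12[of m] m less.prems by simp
  qed
qed

subsection \<open>Necessity\<close>

definition star :: "'a ugraph \<Rightarrow> 'a \<Rightarrow> 'a set set" where
  "star G v = {e \<in> edges G. v \<in> e}"

text \<open>Turning the isomorphism around presents a part as an injective image of the concrete
  model, where sizes and degrees can be computed.\<close>

lemma isomorphic_image:
  assumes "isomorphic B G" "simple_graph B" "simple_graph G"
  obtains h where "inj_on h (verts G)" "verts B = h ` verts G" "edges B = (`) h ` edges G"
proof -
  obtain f where f: "bij_betw f (verts B) (verts G)"
    and iff: "\<And>u v. u \<in> verts B \<Longrightarrow> v \<in> verts B \<Longrightarrow> {u, v} \<in> edges B \<longleftrightarrow> {f u, f v} \<in> edges G"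
    using assms(1) unfolding isomorphic_def by blast
  define h where "h = inv_into (verts B) f"
  have h: "bij_betw h (verts G) (verts B)"
    unfolding h_def by (rule bij_betw_inv_into[OF f])
  have fh: "f (h x) = x" if "x \<in> verts G" for x
    using f that unfolding h_def by (rule bij_betw_inv_into_right)
  have hin: "h x \<in> verts B" if "x \<in> verts G" for x
    using h that by (rule bij_betwE[rule_format])
  have "edges B = (`) h ` edges G"
  proof (intro equalityI subsetI)
    fix e assume e: "e \<in> edges B"
    then have "e \<subseteq> verts B" "card e = 2"
      using assms(2) by (auto simp: simple_graph_def all_edges_def)
    then obtain u v where uv: "e = {u, v}" "u \<in> verts B" "v \<in> verts B"
      by (auto simp: card_2_iff)
    have "h (f u) = u" "h (f v) = v"
      using f uv unfolding h_def by (simp_all add: bij_betw_inv_into_left)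
    then have "e = h ` {f u, f v}"
      using uv by simp
    moreover have "{f u, f v} \<in> edges G"
      using iff uv e by blast
    ultimately show "e \<in> (`) h ` edges G"
      by (rule image_eqI)
  next
    fix e assume "e \<in> (`) h ` edges G"
    then obtain d where d: "d \<in> edges G" "e = h ` d"
      by blast
    then have "d \<subseteq> verts G" "card d = 2"
      using assms(3) by (auto simp: simple_graph_def all_edges_def)
    then obtain x y where xy: "d = {x, y}" "x \<in> verts G" "y \<in> verts G"
      by (auto simp: card_2_iff)
    show "e \<in> edges B"
      using iff[of "h x" "h y"] xy d fh hin by simp
  qed
  then show ?thesis
    using h that[of h] by (simp add: bij_betw_def)
qed

lemma card_verts_isomorphic:
  assumes "isomorphic B G" "simple_graph B" "simple_graph G"
  shows "card (verts B) = card (verts G)"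
  using isomorphic_image[OF assms] by (metis card_image)

lemma card_edges_isomorphic:
  assumes "isomorphic B G" "simple_graph B" "simple_graph G"
  shows "card (edges B) = card (edges G)"
proof -
  obtain h where h: "inj_on h (verts G)" "edges B = (`) h ` edges G"
    using isomorphic_image[OF assms] by metis
  have "inj_on ((`) h) (edges G)"
    using assms(3) by (intro inj_on_subset[OF inj_on_image_Pow[OF h(1)]])
      (auto simp: simple_graph_def all_edges_def)
  then show ?thesis
    by (simp add: h(2) card_image)
qed

lemma card_star_isomorphic:
  assumes "isomorphic B G" "simple_graph B" "simple_graph G"
    and "\<And>x. x \<in> verts G \<Longrightarrow> card (star G x) = d"
    and "v \<in> verts B"
  shows "card (star B v) = d"
proof -
  obtain h where h: "inj_on h (verts G)" "verts B = h ` verts G" "edges B = (`) h ` edges G"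
    using isomorphic_image[OF assms(1-3)] by metis
  obtain x where x: "x \<in> verts G" "v = h x"
    using assms(5) h(2) by blast
  have sub: "e \<subseteq> verts G" if "e \<in> edges G" for e
    using assms(3) that by (auto simp: simple_graph_def all_edges_def)
  have "inj_on ((`) h) (star G x)"
    using sub by (intro inj_on_subset[OF inj_on_image_Pow[OF h(1)]]) (auto simp: star_def)
  moreover have "h x \<in> h ` e \<longleftrightarrow> x \<in> e" if "e \<in> edges G" for e
    using inj_on_image_mem_iff[OF h(1) x(1) sub[OF that]] .
  then have "star B v = (`) h ` star G x"
    unfolding star_def h(3) x(2) by blast
  ultimately show ?thesis
    using assms(4)[OF x(1)] by (simp add: card_image)
qed

text \<open>As a sum of indicators, the count can be evaluated on explicit sets, and orders of
  summation can be exchanged in double counting.\<close>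

lemma card_filter_eq_sum: "finite S \<Longrightarrow> card {e \<in> S. P e} = (\<Sum>e\<in>S. if P e then 1 else 0)"
  by (simp add: sum.If_cases Int_def)

lemma card_edges_C6: "card (edges C6) = 6"
  unfolding edges_cycle_graph_6 by (simp add: doubleton_eq_iff)

lemma card_edges_prism: "card (edges prism) = 9"
  unfolding edges_complement_cycle_graph_6 by (simp add: doubleton_eq_iff)

lemma card_star_C6: "x \<in> verts C6 \<Longrightarrow> card (star C6 x) = 2"
  unfolding verts_C6 lessThan_6 star_def edges_cycle_graph_6
  by (subst card_filter_eq_sum, simp, elim insertE emptyE) (simp_all add: doubleton_eq_iff)

lemma card_star_prism: "x \<in> verts prism \<Longrightarrow> card (star prism x) = 3"
  unfolding verts_prism lessThan_6 star_def edges_complement_cycle_graph_6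
  by (subst card_filter_eq_sum, simp, elim insertE emptyE) (simp_all add: doubleton_eq_iff)

lemma card_all_edges: "finite A \<Longrightarrow> card (all_edges A) = card A choose 2"
  unfolding all_edges_def by (rule n_subsets)

lemma finite_all_edges: "finite A \<Longrightarrow> finite (all_edges A)"
  unfolding all_edges_def by simp

lemma card_star_complete_graph:
  assumes "v < n"
  shows "card (star (complete_graph n) v) = n - 1"
proof -
  have "star (complete_graph n) v = (\<lambda>u. {v, u}) ` ({..<n} - {v})"
  proof (intro equalityI subsetI)
    fix e assume "e \<in> star (complete_graph n) v"
    then have "card e = 2" "v \<in> e" "e \<subseteq> {..<n}"
      by (auto simp: star_def complete_graph_def all_edges_def)
    then show "e \<in> (\<lambda>u. {v, u}) ` ({..<n} - {v})"
      by (auto simp: card_2_iff)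
  next
    fix e assume "e \<in> (\<lambda>u. {v, u}) ` ({..<n} - {v})"
    then show "e \<in> star (complete_graph n) v"
      using assms by (auto simp: star_def complete_graph_def all_edges_def)
  qed
  moreover have "inj_on (\<lambda>u. {v, u}) ({..<n} - {v})"
    by (auto simp: inj_on_def doubleton_eq_iff)
  ultimately show ?thesis
    using assms by (simp add: card_image)
qed

section \<open>Counting edges, degrees and incidences in a decomposition\<close>

locale complete_graph_multidecomposition =
  fixes n :: nat and D :: "nat ugraph set"
  assumes multidecomposition: "multidecomposition C6 prism (complete_graph n) D"
begin

definition cycles :: "nat ugraph set" where
  "cycles = {B \<in> D. isomorphic B C6}"

definition prisms :: "nat ugraph set" where
  "prisms = {B \<in> D. isomorphic B prism}"

definition num_prisms :: "nat \<Rightarrow> nat" where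
  "num_prisms v = card {B \<in> prisms. v \<in> verts B}"

lemma D_eq: "D = cycles \<union> prisms"
  using multidecomposition by (auto simp: multidecomposition_def cycles_def prisms_def)

lemma part_iff: "B \<in> D \<longleftrightarrow> B \<in> cycles \<or> B \<in> prisms"
  using D_eq by blast

lemma nonempty: "cycles \<noteq> {}" "prisms \<noteq> {}"
  using multidecomposition by (auto simp: multidecomposition_def cycles_def prisms_def)

lemma simple_graph_part: "B \<in> D \<Longrightarrow> simple_graph B"
  and verts_part: "B \<in> D \<Longrightarrow> verts B \<subseteq> {..<n}"
  using multidecomposition
  by (auto simp: multidecomposition_def subgraph_def complete_graph_def)

lemma edges_eq: "(\<Union>B\<in>D. edges B) = all_edges {..<n}"
  using multidecomposition by (simp add: multidecomposition_def complete_graph_def)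

lemma disjoint_edges: "A \<in> D \<Longrightarrow> B \<in> D \<Longrightarrow> A \<noteq> B \<Longrightarrow> edges A \<inter> edges B = {}"
  using multidecomposition by (simp add: multidecomposition_def disjoint_family_on_def)

lemma card_edges_cycles: "B \<in> cycles \<Longrightarrow> card (edges B) = 6"
  using card_edges_isomorphic[of B C6] simple_graph_part
  by (simp add: cycles_def simple_graph_cycle_graph_6 card_edges_C6)

lemma card_edges_prisms: "B \<in> prisms \<Longrightarrow> card (edges B) = 9"
  using card_edges_isomorphic[of B prism] simple_graph_part
  by (simp add: prisms_def simple_graph_prism card_edges_prism)

lemma cycles_Int_prisms: "cycles \<inter> prisms = {}"
  using card_edges_cycles card_edges_prisms by fastforce

lemma card_verts_part: "B \<in> D \<Longrightarrow> card (verts B) = 6"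
  using card_verts_isomorphic[of B C6] card_verts_isomorphic[of B prism] simple_graph_part D_eq
  by (auto simp: cycles_def prisms_def simple_graph_prism simple_graph_cycle_graph_6
      verts_prism verts_C6)

lemma finite_edges: "B \<in> D \<Longrightarrow> finite (edges B)"
  using finite_all_edges[of "{..<n}"] edges_eq by (metis UN_upper finite_lessThan finite_subset)

text \<open>Two different parts with equal edge sets would be disjoint from each other and hence
  have no edges, but parts have 6 or 9. So a part is determined by its edge set, and there are
  finitely many of those.\<close>

lemma finite_D: "finite D"
proof (rule inj_on_finite)
  show "inj_on edges D"
  proof (rule inj_onI, rule ccontr)
    fix A B assume AB: "A \<in> D" "B \<in> D" "edges A = edges B" "A \<noteq> B"
    then have "edges A = {}"
      using disjoint_edges by blast
    then show False
      using AB(1) card_edges_cycles[of A] card_edges_prisms[of A] D_eq by auto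
  qed
  show "edges ` D \<subseteq> Pow (all_edges {..<n})"
    using edges_eq by blast
  show "finite (Pow (all_edges {..<n}))"
    by (simp add: finite_all_edges)
qed

lemma finite_cycles: "finite cycles" and finite_prisms: "finite prisms"
  using finite_D by (auto simp: cycles_def prisms_def)

lemma sum_D: "sum f D = sum f cycles + sum f prisms"
  using sum.union_disjoint[OF finite_cycles finite_prisms cycles_Int_prisms] D_eq by metis

lemma edge_count: "n choose 2 = 6 * card cycles + 9 * card prisms"
proof -
  have "n choose 2 = card (\<Union>B\<in>D. edges B)"
    by (simp add: edges_eq card_all_edges)
  also have "\<dots> = (\<Sum>B\<in>D. card (edges B))"
    using finite_D finite_edges disjoint_edges by (intro card_UN_disjoint) auto
  also have "\<dots> = 6 * card cycles + 9 * card prisms"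
    unfolding sum_D by (simp add: card_edges_cycles card_edges_prisms)
  finally show ?thesis .
qed

lemma card_star_cycles: "B \<in> cycles \<Longrightarrow> v \<in> verts B \<Longrightarrow> card (star B v) = 2"
  using card_star_isomorphic[of B C6 2 v] simple_graph_part card_star_C6
  by (simp add: cycles_def simple_graph_cycle_graph_6)

lemma card_star_prisms: "B \<in> prisms \<Longrightarrow> v \<in> verts B \<Longrightarrow> card (star B v) = 3"
  using card_star_isomorphic[of B prism 3 v] simple_graph_part card_star_prism
  by (simp add: prisms_def simple_graph_prism)

lemma star_outside: "B \<in> D \<Longrightarrow> v \<notin> verts B \<Longrightarrow> star B v = {}"
  using simple_graph_part[of B] by (auto simp: star_def simple_graph_def all_edges_def)

lemma degree:
  assumes "v < n"
  shows "n - 1 = 2 * card {B \<in> cycles. v \<in> verts B} + 3 * num_prisms v"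
proof -
  have "n - 1 = card (\<Union>B\<in>D. star B v)"
  proof -
    have "(\<Union>B\<in>D. star B v) = star (complete_graph n) v"
      using edges_eq by (auto simp: star_def complete_graph_def)
    then show ?thesis
      using card_star_complete_graph[OF assms] by simp
  qed
  also have "\<dots> = (\<Sum>B\<in>D. card (star B v))"
    using finite_D finite_edges disjoint_edges
    by (intro card_UN_disjoint) (auto simp: star_def)
  also have "\<dots> = (\<Sum>B\<in>cycles. if v \<in> verts B then 2 else 0) +
      (\<Sum>B\<in>prisms. if v \<in> verts B then 3 else 0)"
    unfolding sum_D using card_star_cycles card_star_prisms star_outside
    by (intro arg_cong2[of _ _ _ _ "(+)"] sum.cong) (auto simp: part_iff)
  also have "\<dots> = 2 * card {B \<in> cycles. v \<in> verts B} + 3 * num_prisms v"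
    using finite_cycles finite_prisms by (simp add: sum.If_cases Int_def num_prisms_def)
  finally show ?thesis .
qed

text \<open>Counts the incidences between vertices and prisms in two ways, each prism having six
  vertices.\<close>

lemma sum_num_prisms: "(\<Sum>v<n. num_prisms v) = 6 * card prisms"
proof -
  have "(\<Sum>v<n. num_prisms v) = (\<Sum>v<n. \<Sum>B\<in>prisms. if v \<in> verts B then 1 else 0)"
    unfolding num_prisms_def using finite_prisms by (simp add: card_filter_eq_sum)
  also have "\<dots> = (\<Sum>B\<in>prisms. \<Sum>v<n. if v \<in> verts B then 1 else 0)"
    by (rule sum.swap)
  also have "\<dots> = (\<Sum>B\<in>prisms. 6)"
  proof (rule sum.cong[OF refl])
    fix B assume "B \<in> prisms"
    then have "{v \<in> {..<n}. v \<in> verts B} = verts B" "card (verts B) = 6"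
      using verts_part card_verts_part D_eq by auto
    then show "(\<Sum>v<n. if v \<in> verts B then 1 else 0) = (6::nat)"
      using card_filter_eq_sum[of "{..<n}" "\<lambda>v. v \<in> verts B"] by simp
  qed
  finally show ?thesis
    by simp
qed

lemma num_prisms_pos: "B \<in> prisms \<Longrightarrow> v \<in> verts B \<Longrightarrow> num_prisms v > 0"
  unfolding num_prisms_def using finite_prisms by (auto simp: card_gt_0_iff)

lemma num_prisms_le: "num_prisms v \<le> card prisms"
  unfolding num_prisms_def using finite_prisms by (intro card_mono) auto

lemma card_cycles_pos: "card cycles > 0" and card_prisms_pos: "card prisms > 0"
  using nonempty finite_cycles finite_prisms by (auto simp: card_gt_0_iff)

section \<open>The excluded orders\<close>

lemma ge_6: "n \<ge> 6"
proof -
  obtain B where "B \<in> D"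
    using nonempty D_eq by blast
  then show ?thesis
    using card_mono[OF _ verts_part, of B] card_verts_part[of B] by simp
qed

lemma mod_3: "n mod 3 \<noteq> 2"
proof
  assume "n mod 3 = 2"
  then obtain k where k: "n = 3 * k + 2"
    by (metis div_mult_mod_eq mult.commute)
  \<comment> \<open>The product is \<open>9 * k * k + 9 * k + 2\<close>, with remainder 2 modulo 3,
    whereas twice the number of edges is a multiple of 3.\<close>
  have "3 * (3 * k * k + 3 * k) + 2 = n * (n - 1)"
    by (simp add: k algebra_simps)
  also have "\<dots> = 2 * (n choose 2)"
    by (simp add: k choose_two)
  also have "\<dots> = 3 * (4 * card cycles + 6 * card prisms)"
    by (simp add: edge_count)
  finally show False
    by presburger
qed

lemma obtain_prism: obtains B v where "B \<in> prisms" "v \<in> verts B" "v < n"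
proof -
  obtain B where "B \<in> prisms"
    using nonempty by blast
  moreover from this have "verts B \<noteq> {}" "verts B \<subseteq> {..<n}"
    using card_verts_part[of B] verts_part[of B] part_iff by auto
  ultimately show ?thesis
    using that[of B] by blast
qed

lemma neq_7: "n \<noteq> 7"
proof
  assume n: "n = 7"
  have "21 = 6 * card cycles + 9 * card prisms"
    using edge_count by (simp add: n choose_two)
  then have "card prisms = 1"
    using card_cycles_pos card_prisms_pos by presburger
  obtain B v where v: "B \<in> prisms" "v \<in> verts B" "v < n"
    by (rule obtain_prism)
  then have "num_prisms v = 1"
    using num_prisms_pos num_prisms_le[of v] \<open>card prisms = 1\<close> by force
  then show False
    using degree[OF v(3)] n by simp presburger
qed

lemma neq_9: "n \<noteq> 9"
proof
  assume n: "n = 9"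
  have "36 = 6 * card cycles + 9 * card prisms"
    using edge_count by (simp add: n choose_two)
  \<comment> \<open>The number of prisms is even, and four of them would use all 36 edges and leave
    no cycle.\<close>
  then have "card prisms = 2"
    using card_cycles_pos card_prisms_pos by presburger
  then obtain A B where AB: "prisms = {A, B}" "A \<noteq> B"
    by (auto simp: card_2_iff)
  then have D: "A \<in> D" "B \<in> D"
    using D_eq by auto
  have "verts A \<subseteq> verts B"
  proof
    fix v assume v: "v \<in> verts A"
    then have "v < n"
      using verts_part[OF D(1)] by auto
    from degree[OF this] have "even (num_prisms v)"
      using n by simp presburger
    moreover have "num_prisms v = 1" if "v \<notin> verts B"
    proof -
      have "{C \<in> prisms. v \<in> verts C} = {A}"
        using that v AB by auto
      then show ?thesis
        by (simp add: num_prisms_def)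
    qed
    ultimately show "v \<in> verts B"
      by fastforce
  qed
  then have "verts A = verts B"
    using D card_verts_part verts_part by (intro card_subset_eq finite_subset[OF verts_part]) auto
  then have "edges A \<union> edges B \<subseteq> all_edges (verts B)"
    using simple_graph_part D unfolding simple_graph_def by (metis Un_least)
  moreover have "finite (verts B)"
    using simple_graph_part D by (simp add: simple_graph_def)
  ultimately have "card (edges A \<union> edges B) \<le> card (verts B) choose 2"
    by (metis card_mono card_all_edges finite_all_edges)
  moreover have "card (edges A \<union> edges B) = 18"
    using D AB disjoint_edges[of A B] card_edges_prisms finite_edges by (simp add: card_Un_disjoint)
  ultimately show False
    using card_verts_part[OF D(2)] by (simp add: choose_two)
qed

lemma neq_10: "n \<noteq> 10"
proof
  assume n: "n = 10"
  have odd: "odd (num_prisms v)" if "v < 10" for v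
    using degree[of v] that n by simp presburger
  have "45 = 6 * card cycles + 9 * card prisms"
    using edge_count by (simp add: n choose_two)
  then have "card prisms = 1 \<or> card prisms = 3"
    using card_cycles_pos card_prisms_pos by presburger
  moreover have "(\<Sum>v<10. num_prisms v) \<ge> (\<Sum>v<10::nat. 1)"
    using odd by (intro sum_mono) (auto simp: Suc_le_eq odd_pos)
  then have "6 * card prisms \<ge> 10"
    using sum_num_prisms n by simp
  ultimately have 3: "card prisms = 3"
    by auto
  define S where "S = {v \<in> {..<10}. num_prisms v = 3}"
  \<comment> \<open>Odd and at most 3 means 1 or 3; in this form the sum over all vertices counts
    \<open>S\<close>, giving 18 = 10 + 2 |S|.\<close>
  have "num_prisms v = 1 + 2 * (if num_prisms v = 3 then 1 else 0)" if "v < 10" for v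
    using odd[OF that] num_prisms_le[of v] 3 by simp presburger
  then have "(\<Sum>v<10. num_prisms v) = (\<Sum>v<10. 1 + 2 * (if num_prisms v = 3 then 1 else 0))"
    by (intro sum.cong) auto
  also have "\<dots> = 10 + 2 * (\<Sum>v<10. if num_prisms v = 3 then 1 else 0)"
    by (simp only: sum.distrib sum_distrib_left[symmetric]) simp
  also have "(\<Sum>v<10. if num_prisms v = 3 then 1 else 0) = card S"
    unfolding S_def by (rule card_filter_eq_sum[symmetric]) simp
  finally have S: "card S = 4" "finite S"
    using sum_num_prisms n 3 by (simp_all add: S_def)
  define inner where "inner B = {e \<in> edges B. e \<subseteq> S}" for B :: "nat ugraph"
  have inner: "card (inner B) \<ge> 3" if B: "B \<in> prisms" for B
  proof -
    have BD: "B \<in> D"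
      using B D_eq by auto
    have fin: "finite (verts B)"
      using simple_graph_part[OF BD] by (simp add: simple_graph_def)
    have "S \<subseteq> verts B"
    proof
      fix v assume "v \<in> S"
      then have "{C \<in> prisms. v \<in> verts C} = prisms"
        using 3 finite_prisms by (intro card_subset_eq) (auto simp: S_def num_prisms_def)
      then show "v \<in> verts B"
        using B by blast
    qed
    then have two: "card (verts B - S) = 2"
      using S card_verts_part[OF BD] by (simp add: card_Diff_subset)
    \<comment> \<open>An edge of \<open>B\<close> not inside \<open>S\<close> meets one of the two
      remaining vertices, each of degree 3, so at most six of the nine edges leave
      \<open>S\<close>.\<close>
    have "edges B \<subseteq> inner B \<union> (\<Union>v\<in>verts B - S. star B v)"
      using simple_graph_part[OF BD] by (auto simp: inner_def star_def simple_graph_def all_edges_def)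
    then have "card (edges B) \<le> card (inner B \<union> (\<Union>v\<in>verts B - S. star B v))"
      using finite_edges[OF BD] fin by (intro card_mono) (auto simp: inner_def star_def)
    also have "\<dots> \<le> card (inner B) + card (\<Union>v\<in>verts B - S. star B v)"
      by (rule card_Un_le)
    also have "card (\<Union>v\<in>verts B - S. star B v) \<le> (\<Sum>v\<in>verts B - S. card (star B v))"
      using fin by (intro card_UN_le) auto
    also have "\<dots> = (\<Sum>v\<in>verts B - S. 3)"
      using card_star_prisms[OF B] by (intro sum.cong) auto
    finally show ?thesis
      using card_edges_prisms[OF B] two by simp
  qed
  have "9 = (\<Sum>B\<in>prisms. 3::nat)"
    using 3 by simp
  also have "\<dots> \<le> (\<Sum>B\<in>prisms. card (inner B))"
    using inner by (rule sum_mono)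
  also have "\<dots> = card (\<Union>B\<in>prisms. inner B)"
  proof (rule card_UN_disjoint[symmetric])
    show "\<forall>B\<in>prisms. finite (inner B)"
      using finite_edges part_iff by (auto simp: inner_def)
    show "\<forall>A\<in>prisms. \<forall>B\<in>prisms. A \<noteq> B \<longrightarrow> inner A \<inter> inner B = {}"
      using disjoint_edges D_eq unfolding inner_def by blast
  qed (rule finite_prisms)
  also have "\<dots> \<le> card (all_edges S)"
  proof (rule card_mono)
    show "(\<Union>B\<in>prisms. inner B) \<subseteq> all_edges S"
      using simple_graph_part D_eq unfolding inner_def simple_graph_def all_edges_def by blast
  qed (rule finite_all_edges[OF S(2)])
  also have "\<dots> = 6"
    using S by (simp add: card_all_edges choose_two)
  finally show False
    by simp
qed

end

theorem theorem1:
  fixes n :: nat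
  assumes "n > 0"
  shows "(\<exists>D. multidecomposition (cycle_graph 6) (complement (cycle_graph 6)) (complete_graph n) D)
    \<longleftrightarrow> (n mod 3 = 0 \<or> n mod 3 = 1) \<and> n \<ge> 6 \<and> n \<notin> {7, 9, 10}"
proof
  assume "\<exists>D. multidecomposition C6 prism (complete_graph n) D"
  then obtain D where "complete_graph_multidecomposition n D"
    by (auto simp: complete_graph_multidecomposition_def)
  then interpret complete_graph_multidecomposition n D .
  show "(n mod 3 = 0 \<or> n mod 3 = 1) \<and> n \<ge> 6 \<and> n \<notin> {7, 9, 10}"
    using mod_3 ge_6 neq_7 neq_9 neq_10 by auto
next
  assume n: "(n mod 3 = 0 \<or> n mod 3 = 1) \<and> n \<ge> 6 \<and> n \<notin> {7, 9, 10}"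
  have "multidecomposable (all_edges {..<n})"
  proof (cases "even n")
    case True
    then show ?thesis
      using n by (intro multidecomposable_even) auto
  next
    case False
    have "n \<in> {6, 7, 8, 9, 10, 11, 12}" if "n < 13"
      using n that by auto
    \<comment> \<open>Among the smaller odd orders, 7 and 9 are excluded outright and 11 by its
      residue.\<close>
    then have "n \<ge> 13"
      using n False by (cases "n < 13") auto
    then show ?thesis
      using n False by (intro multidecomposable_odd) auto
  qed
  then show "\<exists>D. multidecomposition C6 prism (complete_graph n) D"
    by (rule multidecomposition_exI)
qed

end
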